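(* Let $\mathcal{C}\subseteq\mathbb{Z}_2^\alpha\times R^\beta$ be a $\mathbb{Z}_2R$ linear self-dual code of length $\ell=\alpha+\beta$ and type $(\alpha,\beta;\gamma,\delta;\kappa)$, with generator matrix whose rows are $(\mathbf g_i|\mathbf r_i)$, $\mathbf g_i\in\mathbb{Z}_2^\alpha$, $\mathbf r_i\in R^\beta$, $1\le i\le\gamma+\delta$. Let $\mathbf y\in R^\beta$ with $wt_L(\mathbf y)$ odd, and let $\mathbf x\in\mathbb{Z}_2^\alpha$ be such that $wt_H(\mathbf x)$ is even and $\langle\mathbf g_i,\mathbf x\rangle=0$ for $1\le i\le\gamma+\delta$. Let $t$ be a unit in $R$ and $s_i=\langle\mathbf r_i,\mathbf y\rangle$ for $1\le i\le\gamma+\delta$. Then the matrix $$G=\left(\begin{array}{c|ccc}\mathbf x&1&0&\mathbf y\\ \hline \mathbf g_1&s_1&ts_1&\mathbf r_1\\ \vdots&\vdots&\vdots&\vdots\\ \mathbf g_{\gamma+\delta}&s_{\gamma+\delta}&ts_{\gamma+\delta}&\mathbf r_{\gamma+\delta}\end{array}\right)$$ generates a self-dual code $\mathcal{E}\subseteq\mathbb{Z}_2^\alpha\times R^{\beta+2}$ over $\mathbb{Z}_2R$ of length $\ell+2$. Moreover, $\mathcal{E}$ is separable if and only if $\mathcal{C}$ is separable.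
   Context: Let $R=\mathbb{Z}_2+u\mathbb{Z}_2=\{0,1,u,1+u\}$ with $u^2=0$ (units $1$, $1+u$), and $\eta:R\to\mathbb{Z}_2$, $\eta(r+uq)=r$. The set $\mathbb{Z}_2^\alpha\times R^\beta$ is an $R$-module under $d(a_1,\dots,a_\alpha\mid b_1,\dots,b_\beta)=(\eta(d)a_1,\dots,\eta(d)a_\alpha\mid db_1,\dots,db_\beta)$. A $\mathbb{Z}_2R$ linear code is an $R$-submodule $\mathcal{C}$ of $\mathbb{Z}_2^\alpha\times R^\beta$; a generator matrix is one whose rows generate the code as an $R$-module. Type $(\alpha,\beta;\gamma,\delta;\kappa)$ means $\mathcal{C}\cong(R/uR)^\gamma\oplus R^\delta$ as an $R$-module, and $\kappa=\dim_{\mathbb{Z}_2}$ of the projection to the first $\alpha$ coordinates of the subcode of codewords whose last $\beta$ coordinates lie in $\{0,u\}$. The inner product is $\langle(\mathbf v|\mathbf w),(\mathbf x|\mathbf y)\rangle=u\sum_{i=1}^\alpha v_ix_i+\sum_{j=1}^\beta w_jy_j\in R$; $\mathcal{C}^\perp$ is the set of vectors orthogonal to all of $\mathcal{C}$; $\mathcal{C}$ is self-dual if $\mathcal{C}=\mathcal{C}^\perp$. For two vectors in $\mathbb{Z}_2^\alpha$, or two vectors in $R^\beta$, $\langle\cdot,\cdot\rangle$ is the usual dot product with values in $\mathbb{Z}_2$, respectively $R$. $wt_H$ is the Hamming weight; the Lee weight is $wt_L(0)=0$, $wt_L(1)=wt_L(1+u)=1$, $wt_L(u)=2$, extended additively to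 $R^\beta$. With $\mathcal{C}_X$, $\mathcal{C}_Y$ the projections of a code $\mathcal{C}$ to its $\mathbb{Z}_2$-coordinates and its $R$-coordinates, $\mathcal{C}$ is separable if $\mathcal{C}=\mathcal{C}_X\times\mathcal{C}_Y$. *)

theory Defs
  imports "Jordan_Normal_Form.VS_Connect" "HOL-Library.Z2" "HOL-Library.FuncSet"
    "HOL-Algebra.QuotRing"
begin

section \<open>The ring \<open>\<int>\<^sub>2 + u\<int>\<^sub>2\<close> with \<open>u\<^sup>2 = 0\<close>\<close>

text \<open>\<open>Z2u r q\<close> stands for \<open>r + u q\<close>; the first selector is the reduction map \<open>\<eta>\<close>.\<close>

datatype z2u = Z2u (eta: bit) (ucoeff: bit)

lemma z2u_cases:
  obtains "a = Z2u 0 0" | "a = Z2u 1 0" | "a = Z2u 0 1" | "a = Z2u 1 1"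
  by (cases a) (metis bit_not_zero_iff)

instantiation z2u :: comm_ring_1
begin

definition zero_z2u :: z2u where "0 = Z2u 0 0"
definition one_z2u :: z2u where "1 = Z2u 1 0"
definition plus_z2u :: "z2u \<Rightarrow> z2u \<Rightarrow> z2u"
  where "a + b = Z2u (eta a + eta b) (ucoeff a + ucoeff b)"
definition uminus_z2u :: "z2u \<Rightarrow> z2u"
  where "- a = Z2u (- eta a) (- ucoeff a)"
definition minus_z2u :: "z2u \<Rightarrow> z2u \<Rightarrow> z2u"
  where "a - b = Z2u (eta a - eta b) (ucoeff a - ucoeff b)"
definition times_z2u :: "z2u \<Rightarrow> z2u \<Rightarrow> z2u"
  where "a * b = Z2u (eta a * eta b) (eta a * ucoeff b + ucoeff a * eta b)"

instance
proof
  fix a b c :: z2u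
  note defs = zero_z2u_def one_z2u_def plus_z2u_def uminus_z2u_def minus_z2u_def times_z2u_def
  show "a + b + c = a + (b + c)" "a * b * c = a * (b * c)" "(a + b) * c = a * c + b * c"
    by (cases a rule: z2u_cases; cases b rule: z2u_cases; cases c rule: z2u_cases;
        simp add: defs)+
  show "a + b = b + a" "a * b = b * a" "a - b = a + - b"
    by (cases a rule: z2u_cases; cases b rule: z2u_cases; simp add: defs)+
  show "0 + a = a" "- a + a = 0" "1 * a = a"
    by (cases a rule: z2u_cases; simp add: defs)+
  show "(0::z2u) \<noteq> 1" by (simp add: defs)
qed

end

definition uu :: z2u where "uu = Z2u 0 1"

definition lift_bit :: "bit \<Rightarrow> z2u" where "lift_bit b = Z2u b 0"

lemmas z2u_defs = zero_z2u_def one_z2u_def plus_z2u_def uminus_z2u_def minus_z2u_def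
  times_z2u_def uu_def lift_bit_def

lemma UNIV_z2u: "UNIV = {0, 1, uu, 1 + uu}"
proof -
  have "a \<in> {0, 1, uu, 1 + uu}" for a
    by (cases a rule: z2u_cases) (simp_all add: z2u_defs)
  then show ?thesis by auto
qed

lemma uu_squared: "uu * uu = 0"
  by (simp add: z2u_defs)

lemma unit_z2u_iff: "t dvd 1 \<longleftrightarrow> t \<in> {1, 1 + uu}" for t :: z2u
proof
  assume "t dvd 1"
  then obtain s where "1 = t * s" ..
  then show "t \<in> {1, 1 + uu}"
    by (cases t rule: z2u_cases) (simp_all add: z2u_defs)
next
  assume "t \<in> {1, 1 + uu}"
  then have "1 = t * t" by (auto simp: z2u_defs)
  then show "t dvd 1" by (rule dvdI)
qed

section \<open>The ambient module and linear codes\<close>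

abbreviation RR :: "z2u ring" where "RR \<equiv> class_ring"

text \<open>\<open>\<int>\<^sub>2\<^sup>\<alpha>\<close> as a module over the four-element ring, which acts through \<open>\<eta>\<close>.
  The record fields \<open>mult\<close> and \<open>one\<close> are irrelevant for modules.\<close>

definition bits_module :: "nat \<Rightarrow> (z2u, bit vec) module" where
  "bits_module n = \<lparr>carrier = carrier_vec n, mult = undefined, one = undefined,
     zero = 0\<^sub>v n, add = (+), smult = (\<lambda>d v. eta d \<cdot>\<^sub>v v)\<rparr>"

definition ambient :: "nat \<Rightarrow> nat \<Rightarrow> (z2u, bit vec \<times> z2u vec) module" where
  "ambient \<alpha> \<beta> = direct_sum (bits_module \<alpha>) (module_vec TYPE(z2u) \<beta>)"

definition linear_code :: "nat \<Rightarrow> nat \<Rightarrow> (bit vec \<times> z2u vec) set \<Rightarrow> bool" where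
  "linear_code \<alpha> \<beta> C \<longleftrightarrow> LinearCombinations.submodule RR C (ambient \<alpha> \<beta>)"

text \<open>A matrix \<open>(A | B)\<close> over \<open>\<int>\<^sub>2\<close> (left block) and the ring (right block) is a pair of
  matrices with the same number of rows.\<close>

definition mixed_rows :: "bit mat \<Rightarrow> z2u mat \<Rightarrow> (bit vec \<times> z2u vec) set" where
  "mixed_rows A B = {(row A i, row B i) | i. i < dim_row A}"

definition generated_code ::
  "nat \<Rightarrow> nat \<Rightarrow> bit mat \<Rightarrow> z2u mat \<Rightarrow> (bit vec \<times> z2u vec) set" where
  "generated_code \<alpha> \<beta> A B = LinearCombinations.module.span RR (ambient \<alpha> \<beta>) (mixed_rows A B)"

definition generator_matrix ::
  "nat \<Rightarrow> nat \<Rightarrow> nat \<Rightarrow> bit mat \<Rightarrow> z2u mat \<Rightarrow> (bit vec \<times> z2u vec) set \<Rightarrow> bool" where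
  "generator_matrix m \<alpha> \<beta> A B C \<longleftrightarrow>
     A \<in> carrier_mat m \<alpha> \<and> B \<in> carrier_mat m \<beta> \<and> generated_code \<alpha> \<beta> A B = C"

section \<open>Type of a code\<close>

abbreviation quot_ring :: "z2u set ring" where
  "quot_ring \<equiv> RR Quot (PIdl\<^bsub>RR\<^esub> uu)"

text \<open>\<open>(R/uR)\<^sup>\<gamma>\<close> as an \<open>R\<close>-module: \<open>\<gamma>\<close>-tuples of cosets, with \<open>d\<close> acting as
  multiplication by the coset of \<open>d\<close>.\<close>

definition quot_power :: "nat \<Rightarrow> (z2u, nat \<Rightarrow> z2u set) module" where
  "quot_power n = \<lparr>carrier = {..<n} \<rightarrow>\<^sub>E carrier quot_ring, mult = undefined, one = undefined,
     zero = (\<lambda>i\<in>{..<n}. \<zero>\<^bsub>quot_ring\<^esub>),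
     add = (\<lambda>f g. \<lambda>i\<in>{..<n}. f i \<oplus>\<^bsub>quot_ring\<^esub> g i),
     smult = (\<lambda>d f. \<lambda>i\<in>{..<n}. (PIdl\<^bsub>RR\<^esub> uu +>\<^bsub>RR\<^esub> d) \<otimes>\<^bsub>quot_ring\<^esub> f i)\<rparr>"

definition module_iso ::
  "('a, 'r) ring_scheme \<Rightarrow> ('a, 'b, 'm) module_scheme \<Rightarrow> ('a, 'c, 'n) module_scheme \<Rightarrow> bool" where
  "module_iso S M N \<longleftrightarrow> (\<exists>f \<in> LinearCombinations.module_hom S M N. bij_betw f (carrier M) (carrier N))"

definition kappa_space :: "nat \<Rightarrow> (bit vec \<times> z2u vec) set \<Rightarrow> bit vec set" where
  "kappa_space \<beta> C = fst ` {c \<in> C. \<forall>j<\<beta>. snd c $ j \<in> {0, uu}}"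

definition code_type ::
  "nat \<Rightarrow> nat \<Rightarrow> nat \<Rightarrow> nat \<Rightarrow> nat \<Rightarrow> (bit vec \<times> z2u vec) set \<Rightarrow> bool" where
  "code_type \<alpha> \<beta> \<gamma> \<delta> \<kappa> C \<longleftrightarrow>
     module_iso RR ((ambient \<alpha> \<beta>)\<lparr>carrier := C\<rparr>)
       (direct_sum (quot_power \<gamma>) (module_vec TYPE(z2u) \<delta>)) \<and>
     vectorspace.dim class_ring ((module_vec TYPE(bit) \<alpha>)\<lparr>carrier := kappa_space \<beta> C\<rparr>) = \<kappa>"

section \<open>Duality, weights and separability\<close>

definition mixed_inner :: "bit vec \<times> z2u vec \<Rightarrow> bit vec \<times> z2u vec \<Rightarrow> z2u" where
  "mixed_inner c d = uu * lift_bit (fst c \<bullet> fst d) + snd c \<bullet> snd d"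

definition dual_code :: "nat \<Rightarrow> nat \<Rightarrow> (bit vec \<times> z2u vec) set \<Rightarrow> (bit vec \<times> z2u vec) set" where
  "dual_code \<alpha> \<beta> C = {d \<in> carrier_vec \<alpha> \<times> carrier_vec \<beta>. \<forall>c\<in>C. mixed_inner d c = 0}"

definition self_dual :: "nat \<Rightarrow> nat \<Rightarrow> (bit vec \<times> z2u vec) set \<Rightarrow> bool" where
  "self_dual \<alpha> \<beta> C \<longleftrightarrow> C = dual_code \<alpha> \<beta> C"

definition wt_H :: "bit vec \<Rightarrow> nat" where
  "wt_H v = card {i. i < dim_vec v \<and> v $ i \<noteq> 0}"

definition lee :: "z2u \<Rightarrow> nat" where
  "lee a = (if a = 0 then 0 else if a = uu then 2 else 1)"

definition wt_L :: "z2u vec \<Rightarrow> nat" where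
  "wt_L v = (\<Sum>j<dim_vec v. lee (v $ j))"

definition separable :: "(bit vec \<times> z2u vec) set \<Rightarrow> bool" where
  "separable C \<longleftrightarrow> C = fst ` C \<times> snd ` C"

section \<open>The module structures are modules\<close>

lemma bits_module_is_module: "Module.module RR (bits_module n)"
proof (rule Module.moduleI)
  show "cring RR" by (rule class_cring.is_cring)
  show "abelian_group (bits_module n)"
    by (rule abelian_groupI)
      (auto simp: bits_module_def intro!: exI[of _ "- _"] bexI[of _ "- _"] comm_add_vec assoc_add_vec)
qed (auto simp: bits_module_def smult_add_distrib_vec add_smult_distrib_vec plus_z2u_def
      times_z2u_def one_z2u_def smult_smult_assoc)

lemma vec_module_z2u: "Module.module RR (module_vec TYPE(z2u) n)"
  by unfold_locales
    (auto simp: module_vec_simps class_ring_simps Units_def add_smult_distrib_vec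
      smult_add_distrib_vec intro!: bexI[of _ "- _"])

lemma ambient_is_module: "Module.module RR (ambient \<alpha> \<beta>)"
  unfolding ambient_def
  by (rule direct_sum_is_module[OF bits_module_is_module vec_module_z2u])

lemma quot_power_is_module: "Module.module RR (quot_power n)"
proof -
  interpret I: ideal "PIdl\<^bsub>RR\<^esub> uu" RR
    by (rule cring.cgenideal_ideal[OF class_cring.is_cring]) simp
  interpret Q: cring quot_ring
    by (rule I.quotient_is_cring) (rule class_cring.is_cring)
  interpret h: ring_hom_ring RR quot_ring "(+>\<^bsub>RR\<^esub>) (PIdl\<^bsub>RR\<^esub> uu)"
    by (rule I.rcos_ring_hom_ring)
  have coset: "PIdl\<^bsub>RR\<^esub> uu +>\<^bsub>RR\<^esub> d \<in> carrier quot_ring" for d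
    using h.hom_closed[of d] by simp
  have coset_add: "PIdl\<^bsub>RR\<^esub> uu +>\<^bsub>RR\<^esub> (a + b) =
      (PIdl\<^bsub>RR\<^esub> uu +>\<^bsub>RR\<^esub> a) \<oplus>\<^bsub>quot_ring\<^esub> (PIdl\<^bsub>RR\<^esub> uu +>\<^bsub>RR\<^esub> b)" for a b
    using h.hom_add[of a b] by simp
  have coset_mult: "PIdl\<^bsub>RR\<^esub> uu +>\<^bsub>RR\<^esub> (a * b) =
      (PIdl\<^bsub>RR\<^esub> uu +>\<^bsub>RR\<^esub> a) \<otimes>\<^bsub>quot_ring\<^esub> (PIdl\<^bsub>RR\<^esub> uu +>\<^bsub>RR\<^esub> b)" for a b
    using h.hom_mult[of a b] by simp
  have coset_one: "PIdl\<^bsub>RR\<^esub> uu +>\<^bsub>RR\<^esub> 1 = \<one>\<^bsub>quot_ring\<^esub>"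
    using h.hom_one by simp
  show ?thesis
  proof (rule Module.moduleI)
    show "cring RR" by (rule class_cring.is_cring)
    show "abelian_group (quot_power n)"
    proof (rule abelian_groupI)
      fix f assume f: "f \<in> carrier (quot_power n)"
      define g where "g = (\<lambda>i\<in>{..<n}. \<ominus>\<^bsub>quot_ring\<^esub> f i)"
      have "g \<in> carrier (quot_power n)" "g \<oplus>\<^bsub>quot_power n\<^esub> f = \<zero>\<^bsub>quot_power n\<^esub>"
        using f by (auto simp: g_def quot_power_def PiE_iff Q.l_neg fun_eq_iff restrict_def
            extensional_def)
      then show "\<exists>g \<in> carrier (quot_power n). g \<oplus>\<^bsub>quot_power n\<^esub> f = \<zero>\<^bsub>quot_power n\<^esub>"
        by blast
    qed (auto simp: quot_power_def PiE_iff Q.a_ac fun_eq_iff restrict_def extensional_def)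
  qed (auto simp: quot_power_def PiE_iff coset coset_add coset_mult coset_one Q.l_distr Q.r_distr
         Q.m_assoc fun_eq_iff restrict_def extensional_def)
qed

end

theory Submission
  imports Defs
begin

text \<open>Since \<open>(x | 0)\<close> is orthogonal to every generator, it lies in \<open>C = C\<^sup>\<bottom>\<close>. Hence \<open>x\<close> can be
  cleared from the first row of the new generator matrix, and \<open>E\<close> consists of the vectors
  \<open>(g | d + \<langle>r, y\<rangle>, t \<langle>r, y\<rangle>, d y + r)\<close> with \<open>(g | r) \<in> C\<close> and \<open>d \<in> R\<close>. In characteristic two,
  \<open>t\<^sup>2 = 1\<close> and \<open>\<langle>y, y\<rangle> = wt\<^sub>L(y) = 1\<close> make this set self-orthogonal. Conversely, if
  \<open>(a | p, q, b)\<close> is orthogonal to it, then \<open>p = \<langle>b, y\<rangle>\<close> and, with \<open>d = p + t q\<close>, the vector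
  \<open>(a | b + d y)\<close> is orthogonal to \<open>C\<close>; so it lies in \<open>C\<close>, and together with \<open>d\<close> it yields
  \<open>(a | p, q, b)\<close>. A submodule is separable iff it contains \<open>(g | 0)\<close> for each of its words
  \<open>(g | r)\<close>, and \<open>(g | 0) \<in> C\<close> iff \<open>(g | 0, 0, 0) \<in> E\<close>.\<close>

section \<open>Arithmetic of the ring\<close>

lemma z2u_add_self [simp]: "a + a = (0::z2u)"
  by (cases a rule: z2u_cases) (simp_all add: z2u_defs)

lemma z2u_add_self_left [simp]: "a + (a + b) = (b::z2u)"
  by (simp flip: add.assoc)

lemma z2u_add_eq_0_iff [simp]: "a + b = 0 \<longleftrightarrow> a = (b::z2u)"
  by (metis add_0 z2u_add_self_left add.commute)

text \<open>In characteristic two with \<open>uu * uu = 0\<close>, also \<open>1 + uu\<close>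
  squares to 1. So \<open>t\<close> is its own inverse, the form in which it enters the later
  lemmas.\<close>

lemma z2u_unit_square:
  fixes t :: z2u
  assumes "t dvd 1"
  shows "t * t = 1"
  using assms by (auto simp: unit_z2u_iff z2u_defs)

lemma z2u_two [simp]: "2 = (0::z2u)"
  by (simp flip: one_add_one)

text \<open>Units square to 1, while 0 and \<open>uu\<close> square to 0; the Lee weight is odd
  exactly on the units, and \<open>of_nat\<close> keeps only the parity. Summed over the
  coordinates, this turns the odd weight of \<open>y\<close> into
  \<open>y \<bullet> y = 1\<close>.\<close>

lemma z2u_square_eq_lee: "a * a = of_nat (lee a)" for a :: z2u
  by (cases a rule: z2u_cases) (auto simp: lee_def z2u_defs)

lemma of_nat_z2u_odd: "of_nat n = (1::z2u)" if "odd n"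
  using that by (auto elim!: oddE simp: mult_2)

lemma eta_simps [simp]: "eta (a + b) = eta a + eta b" "eta (a * b) = eta a * eta b"
  by (simp_all add: z2u_defs)

lemma uu_lift_bit_add: "uu * lift_bit (a + b) = uu * lift_bit a + uu * lift_bit b"
  by (simp add: z2u_defs)

text \<open>Multiplication by \<open>uu\<close> kills the \<open>uu\<close>-part of
  \<open>d\<close>. This makes the binary part of the inner product linear over the ring.\<close>

lemma uu_lift_bit_mult: "uu * lift_bit (eta d * a) = d * (uu * lift_bit a)"
  by (simp add: z2u_defs)

lemma uu_lift_bit_0 [simp]: "uu * lift_bit 0 = 0"
  by (simp add: z2u_defs)

lemma scalar_prod_self_eq_wt_L: "y \<bullet> y = of_nat (wt_L y)" for y :: "z2u vec"
  by (simp add: scalar_prod_def wt_L_def z2u_square_eq_lee atLeast0LessThan)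

section \<open>Linear codes\<close>

lemma ambient_simps [simp]:
  "carrier (ambient \<alpha> \<beta>) = carrier_vec \<alpha> \<times> carrier_vec \<beta>"
  "(a, b) \<oplus>\<^bsub>ambient \<alpha> \<beta>\<^esub> (a', b') = (a + a', b + b')"
  "\<zero>\<^bsub>ambient \<alpha> \<beta>\<^esub> = (0\<^sub>v \<alpha>, 0\<^sub>v \<beta>)"
  "d \<odot>\<^bsub>ambient \<alpha> \<beta>\<^esub> (a, b) = (eta d \<cdot>\<^sub>v a, d \<cdot>\<^sub>v b)"
  by (simp_all add: ambient_def direct_sum_def bits_module_def module_vec_simps)

lemma linear_code_iff:
  "linear_code \<alpha> \<beta> C \<longleftrightarrow> C \<subseteq> carrier_vec \<alpha> \<times> carrier_vec \<beta> \<and> (0\<^sub>v \<alpha>, 0\<^sub>v \<beta>) \<in> C \<and>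
     (\<forall>g r g' r'. (g, r) \<in> C \<longrightarrow> (g', r') \<in> C \<longrightarrow> (g + g', r + r') \<in> C) \<and>
     (\<forall>d g r. (g, r) \<in> C \<longrightarrow> (eta d \<cdot>\<^sub>v g, d \<cdot>\<^sub>v r) \<in> C)"
  by (auto simp: linear_code_def submodule_def ambient_is_module)

lemma
  assumes "linear_code \<alpha> \<beta> C"
  shows linear_code_carrier: "(g, r) \<in> C \<Longrightarrow> g \<in> carrier_vec \<alpha> \<and> r \<in> carrier_vec \<beta>"
    and linear_code_zero: "(0\<^sub>v \<alpha>, 0\<^sub>v \<beta>) \<in> C"
    and linear_code_add: "(g, r) \<in> C \<Longrightarrow> (g', r') \<in> C \<Longrightarrow> (g + g', r + r') \<in> C"
    and linear_code_smult: "(g, r) \<in> C \<Longrightarrow> (eta d \<cdot>\<^sub>v g, d \<cdot>\<^sub>v r) \<in> C"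
  using assms unfolding linear_code_iff by blast+

lemma generated_code_linear:
  assumes "A \<in> carrier_mat m \<alpha>" "B \<in> carrier_mat m \<beta>"
  shows "linear_code \<alpha> \<beta> (generated_code \<alpha> \<beta> A B)"
  unfolding linear_code_def generated_code_def
  using assms by (intro module.span_is_submodule ambient_is_module) (auto simp: mixed_rows_def)

lemma generated_code_rows:
  assumes "A \<in> carrier_mat m \<alpha>" "B \<in> carrier_mat m \<beta>"
  shows "mixed_rows A B \<subseteq> generated_code \<alpha> \<beta> A B"
  unfolding generated_code_def
  using assms by (intro module.in_own_span ambient_is_module) (auto simp: mixed_rows_def)

text \<open>Serves as an induction principle: a property that defines a linear code and holds for
  the rows holds for every generated word.\<close>

lemma generated_code_least:
  assumes "linear_code \<alpha> \<beta> D" "mixed_rows A B \<subseteq> D"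
  shows "generated_code \<alpha> \<beta> A B \<subseteq> D"
  using assms unfolding linear_code_def generated_code_def
  by (intro module.span_is_subset ambient_is_module)

lemma separable_linear_code_iff:
  assumes "linear_code \<alpha> \<beta> C"
  shows "separable C \<longleftrightarrow> (\<forall>g r. (g, r) \<in> C \<longrightarrow> (g, 0\<^sub>v \<beta>) \<in> C)"
proof
  assume "separable C"
  then show "\<forall>g r. (g, r) \<in> C \<longrightarrow> (g, 0\<^sub>v \<beta>) \<in> C"
    using linear_code_zero[OF assms] unfolding separable_def by force
next
  assume left: "\<forall>g r. (g, r) \<in> C \<longrightarrow> (g, 0\<^sub>v \<beta>) \<in> C"
  have "(g, r') \<in> C" if "(g, r) \<in> C" "(g', r') \<in> C" for g r g' r'
  proof -
    have car: "g \<in> carrier_vec \<alpha>" "g' \<in> carrier_vec \<alpha>" "r' \<in> carrier_vec \<beta>"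
      using linear_code_carrier[OF assms] that by blast+
    \<comment> \<open>In characteristic two, adding \<open>(g', 0)\<close> to
      \<open>(g', r')\<close> isolates the right part \<open>(0, r')\<close>, to which
      \<open>(g, 0)\<close> is then added.\<close>
    have "(g + (g' + g'), 0\<^sub>v \<beta> + (r' + 0\<^sub>v \<beta>)) \<in> C"
      using left that by (intro linear_code_add[OF assms]) blast+
    moreover have "g + (g' + g') = g"
      using car by (intro eq_vecI) auto
    ultimately show ?thesis
      using car by simp
  qed
  then show "separable C"
    unfolding separable_def by force
qed

section \<open>The extended code\<close>

lemma zero_smult_vec [simp]: "(0::'a::semiring_1) \<cdot>\<^sub>v v = 0\<^sub>v (dim_vec v)"
  by (rule eq_vecI) auto

text \<open>Here \<open>d\<close> is the coefficient of the first row after \<open>x\<close> has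
  been cleared, and the rest is a linear image of \<open>(g, r)\<close>. Duality and separability
  can be checked on this form without matrices.\<close>

definition extended_code ::
  "z2u vec \<Rightarrow> z2u \<Rightarrow> (bit vec \<times> z2u vec) set \<Rightarrow> (bit vec \<times> z2u vec) set" where
  "extended_code y t C =
     {(g, vCons (d + r \<bullet> y) (vCons (t * (r \<bullet> y)) (d \<cdot>\<^sub>v y + r))) | g r d. (g, r) \<in> C}"

lemma extended_codeI:
  "(g, r) \<in> C \<Longrightarrow> p = d + r \<bullet> y \<Longrightarrow> q = t * (r \<bullet> y) \<Longrightarrow> b = d \<cdot>\<^sub>v y + r \<Longrightarrow>
    (g, vCons p (vCons q b)) \<in> extended_code y t C"
  unfolding extended_code_def by blast

lemma extended_codeE:
  assumes "(g, v) \<in> extended_code y t C"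
  obtains r d where "(g, r) \<in> C" "v = vCons (d + r \<bullet> y) (vCons (t * (r \<bullet> y)) (d \<cdot>\<^sub>v y + r))"
  using assms unfolding extended_code_def by blast

lemma smult_zero_vec [simp]: "d \<cdot>\<^sub>v 0\<^sub>v n = (0\<^sub>v n :: 'a::semiring_0 vec)"
  by (rule eq_vecI) auto

lemma vCons_add [simp]: "vCons a v + vCons b w = vCons (a + b) (v + w)"
  by (rule eq_vecI) (auto simp: vec_index_vCons less_Suc_eq_0_disj)

lemma vCons_smult [simp]: "d \<cdot>\<^sub>v vCons a v = vCons (d * a) (d \<cdot>\<^sub>v v)"
  by (rule eq_vecI) (auto simp: vec_index_vCons less_Suc_eq_0_disj)

text \<open>The extended word depends linearly on \<open>(g, r)\<close> and \<open>d\<close>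
  together, so these parameters are added and scaled along with the words.\<close>

lemma extended_code_linear:
  assumes C: "linear_code \<alpha> \<beta> C" and y: "y \<in> carrier_vec \<beta>"
  shows "linear_code \<alpha> (\<beta> + 2) (extended_code y t C)"
  unfolding linear_code_iff
proof (intro conjI allI impI)
  note car = linear_code_carrier[OF C]
  show "extended_code y t C \<subseteq> carrier_vec \<alpha> \<times> carrier_vec (\<beta> + 2)"
    using car y by (auto elim!: extended_codeE)
  show "(0\<^sub>v \<alpha>, 0\<^sub>v (\<beta> + 2)) \<in> extended_code y t C"
    using y by (auto simp: zero_vec_Suc intro!: extended_codeI[where d = 0] linear_code_zero[OF C])
  fix g v assume "(g, v) \<in> extended_code y t C"
  then obtain r d where gr: "(g, r) \<in> C"
    and v: "v = vCons (d + r \<bullet> y) (vCons (t * (r \<bullet> y)) (d \<cdot>\<^sub>v y + r))"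
    by (rule extended_codeE)
  note rc = car[OF gr]
  show "(eta e \<cdot>\<^sub>v g, e \<cdot>\<^sub>v v) \<in> extended_code y t C" for e
    unfolding v vCons_smult
    by (rule extended_codeI[OF linear_code_smult[OF C gr], where d = "e * d"])
      (use rc y in \<open>auto simp: algebra_simps smult_add_distrib_vec smult_smult_assoc\<close>)
  fix g' v' assume "(g', v') \<in> extended_code y t C"
  then obtain r' d' where gr': "(g', r') \<in> C"
    and v': "v' = vCons (d' + r' \<bullet> y) (vCons (t * (r' \<bullet> y)) (d' \<cdot>\<^sub>v y + r'))"
    by (rule extended_codeE)
  note rc' = car[OF gr']
  have "d \<cdot>\<^sub>v y + r + (d' \<cdot>\<^sub>v y + r') = (d + d') \<cdot>\<^sub>v y + (r + r')"
    using rc rc' y by (intro eq_vecI) (auto simp: algebra_simps)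
  then show "(g + g', v + v') \<in> extended_code y t C"
    unfolding v v' vCons_add
    by (intro extended_codeI[OF linear_code_add[OF C gr gr'], where d = "d + d'"])
      (use rc rc' y in \<open>auto simp: algebra_simps add_scalar_prod_distrib[of _ \<beta>]\<close>)
qed

text \<open>With \<open>a = r \<bullet> y\<close> and \<open>b = r' \<bullet> y\<close>, the two new
  coordinates contribute \<open>(d + a) * (d' + b) + a * b\<close>, and the old ones
  \<open>d * d' + d * b + d' * a\<close>; every term occurs twice and cancels.\<close>

lemma extended_code_self_orthogonal:
  assumes C: "linear_code \<alpha> \<beta> C" and y: "y \<in> carrier_vec \<beta>"
    and orth: "\<And>c c'. c \<in> C \<Longrightarrow> c' \<in> C \<Longrightarrow> mixed_inner c c' = 0"
    and yy: "y \<bullet> y = 1" and t: "t * t = 1"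
    and e: "e \<in> extended_code y t C" and e': "e' \<in> extended_code y t C"
  shows "mixed_inner e e' = 0"
proof -
  obtain g r d where gr: "(g, r) \<in> C"
    and e_eq: "e = (g, vCons (d + r \<bullet> y) (vCons (t * (r \<bullet> y)) (d \<cdot>\<^sub>v y + r)))"
    using e unfolding extended_code_def by blast
  obtain g' r' d' where gr': "(g', r') \<in> C"
    and e'_eq: "e' = (g', vCons (d' + r' \<bullet> y) (vCons (t * (r' \<bullet> y)) (d' \<cdot>\<^sub>v y + r')))"
    using e' unfolding extended_code_def by blast
  note rc = linear_code_carrier[OF C gr] linear_code_carrier[OF C gr']
  define a b where "a = r \<bullet> y" and "b = r' \<bullet> y"
  have yr: "y \<bullet> r' = b"
    using rc y unfolding b_def by (auto intro: comm_scalar_prod)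
  have rr: "uu * lift_bit (g \<bullet> g') = r \<bullet> r'"
    using orth[OF gr gr'] by (simp add: mixed_inner_def)
  have "(d \<cdot>\<^sub>v y + r) \<bullet> (d' \<cdot>\<^sub>v y + r') = d * d' + d * b + d' * a + r \<bullet> r'"
    using rc y yy yr
    by (simp add: add_scalar_prod_distrib[of _ \<beta>] scalar_prod_add_distrib[of _ \<beta>] a_def
        algebra_simps)
  moreover have "t * a * (t * b) = a * b"
    using t by (metis mult.assoc mult.left_commute mult_1)
  ultimately show ?thesis
    unfolding e_eq e'_eq mixed_inner_def
    by (simp add: rr flip: a_def b_def) (simp add: algebra_simps)
qed

lemma extended_code_self_dual:
  assumes C: "linear_code \<alpha> \<beta> C" and sd: "self_dual \<alpha> \<beta> C" and y: "y \<in> carrier_vec \<beta>"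
    and yy: "y \<bullet> y = 1" and t: "t * t = 1"
  shows "self_dual \<alpha> (\<beta> + 2) (extended_code y t C)" (is "self_dual _ _ ?E")
proof -
  have orth: "mixed_inner c c' = 0" if "c \<in> C" "c' \<in> C" for c c'
    using sd that unfolding self_dual_def dual_code_def by blast
  have "?E \<subseteq> dual_code \<alpha> (\<beta> + 2) ?E"
    using extended_code_linear[OF C y, of t] extended_code_self_orthogonal[OF C y orth yy t]
    unfolding dual_code_def linear_code_iff by auto
  moreover have "dual_code \<alpha> (\<beta> + 2) ?E \<subseteq> ?E"
  proof clarify
    fix a w assume aw: "(a, w) \<in> dual_code \<alpha> (\<beta> + 2) ?E"
    then have a: "a \<in> carrier_vec \<alpha>" and w: "w \<in> carrier_vec (\<beta> + 2)"
      and perp: "\<And>e. e \<in> ?E \<Longrightarrow> mixed_inner (a, w) e = 0"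
      unfolding dual_code_def by auto
    obtain p v where pv: "w = vCons p v"
      using w by (cases w) auto
    moreover obtain q b where "v = vCons q b"
      using w by (cases v) (auto simp: pv)
    ultimately have w_eq: "w = vCons p (vCons q b)" by simp
    have b: "b \<in> carrier_vec \<beta>"
      using w by (simp add: w_eq)
    \<comment> \<open>Testing against the extension of the zero word with \<open>d = 1\<close>
      determines \<open>p\<close>.\<close>
    have "(0\<^sub>v \<alpha>, vCons 1 (vCons 0 y)) \<in> ?E"
      using y by (auto intro!: extended_codeI[OF linear_code_zero[OF C], where d = 1])
    from perp[OF this] have p: "p = b \<bullet> y"
      using a by (simp add: mixed_inner_def w_eq)
    \<comment> \<open>If the vector is an extended word of \<open>(g, r)\<close>, then
      \<open>p = d + r \<bullet> y\<close> and \<open>q = t * (r \<bullet> y)\<close>. As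
      \<open>t\<close> is its own inverse, this forces the choice of \<open>d\<close>.\<close>
    define d where "d = p + q * t"
    have "mixed_inner (a, b + d \<cdot>\<^sub>v y) (g, r) = 0" if gr: "(g, r) \<in> C" for g r
    proof -
      note rc = linear_code_carrier[OF C gr]
      \<comment> \<open>For \<open>d = 0\<close> the new coordinates contribute
        \<open>(p + q * t) * (r \<bullet> y)\<close>, which is the product of
        \<open>d \<cdot>\<^sub>v y\<close> with \<open>r\<close>.\<close>
      have "(g, vCons (r \<bullet> y) (vCons (t * (r \<bullet> y)) r)) \<in> ?E"
        using rc y by (auto intro!: extended_codeI[OF gr, where d = 0])
      from perp[OF this] show ?thesis
        using rc y b comm_scalar_prod[of r \<beta> y]
        by (simp add: mixed_inner_def w_eq d_def add_scalar_prod_distrib[of _ \<beta>] algebra_simps)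
    qed
    then have mem: "(a, b + d \<cdot>\<^sub>v y) \<in> C"
      using sd a b y unfolding self_dual_def dual_code_def by auto
    \<comment> \<open>This uses \<open>b \<bullet> y = p\<close> and
      \<open>y \<bullet> y = 1\<close>; the two copies of \<open>p\<close> then cancel.\<close>
    have "(b + d \<cdot>\<^sub>v y) \<bullet> y = p + d"
      using b y yy by (simp add: add_scalar_prod_distrib[of _ \<beta>] p)
    then have ry: "(b + d \<cdot>\<^sub>v y) \<bullet> y = q * t"
      by (simp add: d_def)
    show "(a, w) \<in> ?E"
      unfolding w_eq
    proof (rule extended_codeI[OF mem, where d = d])
      show "p = d + (b + d \<cdot>\<^sub>v y) \<bullet> y"
        unfolding ry by (simp add: d_def add.assoc)
      show "q = t * ((b + d \<cdot>\<^sub>v y) \<bullet> y)"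
        unfolding ry using t by (metis mult.left_commute mult.right_neutral)
      show "b = d \<cdot>\<^sub>v y + (b + d \<cdot>\<^sub>v y)"
        using b y by (intro eq_vecI) (auto simp: add.left_commute)
    qed
  qed
  ultimately show ?thesis
    unfolding self_dual_def by blast
qed

text \<open>Extension leaves the binary part of a word alone, so both codes have the same binary
  projection; they also contain \<open>(g, 0)\<close> for the same \<open>g\<close>, which decides
  separability.\<close>

lemma extended_code_separable_iff:
  assumes C: "linear_code \<alpha> \<beta> C" and y: "y \<in> carrier_vec \<beta>" and t: "t * t = 1"
  shows "separable (extended_code y t C) \<longleftrightarrow> separable C"
proof -
  have zero: "(g, 0\<^sub>v (\<beta> + 2)) \<in> extended_code y t C \<longleftrightarrow> (g, 0\<^sub>v \<beta>) \<in> C" for g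
  proof
    assume "(g, 0\<^sub>v (\<beta> + 2)) \<in> extended_code y t C"
    then obtain r d where gr: "(g, r) \<in> C" and "d + r \<bullet> y = 0" "t * (r \<bullet> y) = 0"
      and dyr: "d \<cdot>\<^sub>v y + r = 0\<^sub>v \<beta>"
      by (auto elim!: extended_codeE simp: zero_vec_Suc)
    \<comment> \<open>Since \<open>t\<close> is invertible, the second new coordinate gives
      \<open>r \<bullet> y = 0\<close>; then the first gives \<open>d = 0\<close>, and the remaining
      ones give \<open>r = 0\<close>.\<close>
    moreover from this have "r \<bullet> y = 0"
      using t by (metis mult.assoc mult_1 mult_zero_right)
    ultimately have "d = 0" by simp
    with dyr linear_code_carrier[OF C gr] y have "r = 0\<^sub>v \<beta>" by simp
    with gr show "(g, 0\<^sub>v \<beta>) \<in> C" by simp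
  next
    assume "(g, 0\<^sub>v \<beta>) \<in> C"
    then show "(g, 0\<^sub>v (\<beta> + 2)) \<in> extended_code y t C"
      using y by (auto simp: zero_vec_Suc intro!: extended_codeI[where d = 0])
  qed
  have "(\<exists>v. (g, v) \<in> extended_code y t C) \<longleftrightarrow> (\<exists>r. (g, r) \<in> C)" for g
    unfolding extended_code_def by blast
  then show ?thesis
    unfolding separable_linear_code_iff[OF C] separable_linear_code_iff[OF extended_code_linear[OF C y]]
      zero by blast
qed

lemma generated_code_eq_extended_code:
  assumes A: "A \<in> carrier_mat m \<alpha>" and B: "B \<in> carrier_mat m \<beta>"
    and y: "y \<in> carrier_vec \<beta>" and x: "(x, 0\<^sub>v \<beta>) \<in> generated_code \<alpha> \<beta> A B"
    and A': "A' \<in> carrier_mat (Suc m) \<alpha>" and B': "B' \<in> carrier_mat (Suc m) (\<beta> + 2)"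
    and row0: "row A' 0 = x" "row B' 0 = vCons 1 (vCons 0 y)"
    and row_Suc: "\<And>i. i < m \<Longrightarrow> row A' (Suc i) = row A i"
      "\<And>i. i < m \<Longrightarrow> row B' (Suc i) = vCons (row B i \<bullet> y) (vCons (t * (row B i \<bullet> y)) (row B i))"
  shows "generated_code \<alpha> (\<beta> + 2) A' B' = extended_code y t (generated_code \<alpha> \<beta> A B)"
    (is "?E = extended_code y t ?C")
proof
  have C: "linear_code \<alpha> \<beta> ?C" and E: "linear_code \<alpha> (\<beta> + 2) ?E"
    using A B A' B' by (auto intro: generated_code_linear)
  have rows_C: "(row A i, row B i) \<in> ?C" if "i < m" for i
    using generated_code_rows[OF A B] A that unfolding mixed_rows_def by auto
  have rows_E: "(row A' i, row B' i) \<in> ?E" if "i < Suc m" for i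
    using generated_code_rows[OF A' B'] A' that unfolding mixed_rows_def by auto
  \<comment> \<open>The first row extends the codeword \<open>(x, 0)\<close> with
    \<open>d = 1\<close>; each later row extends an old row with \<open>d = 0\<close>.\<close>
  have "(row A' i, row B' i) \<in> extended_code y t ?C" if "i < Suc m" for i
  proof (cases i)
    case 0
    then show ?thesis
      using y by (auto simp: row0 intro!: extended_codeI[OF x, where d = 1])
  next
    case (Suc j)
    then show ?thesis
      using that y B by (auto simp: row_Suc intro!: extended_codeI[OF rows_C, where d = 0])
  qed
  then show "?E \<subseteq> extended_code y t ?C"
    using A' by (intro generated_code_least extended_code_linear[OF C y]) (auto simp: mixed_rows_def)
  \<comment> \<open>The codewords whose extension with \<open>d = 0\<close> is generated form a
    linear code containing the old rows, hence all of \<open>?C\<close>.\<close>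
  define P where "P = {(g, r) \<in> ?C. (g, vCons (r \<bullet> y) (vCons (t * (r \<bullet> y)) r)) \<in> ?E}"
  have "linear_code \<alpha> \<beta> P"
    unfolding linear_code_iff
  proof (intro conjI allI impI)
    show "P \<subseteq> carrier_vec \<alpha> \<times> carrier_vec \<beta>"
      using C unfolding P_def linear_code_iff by blast
    show "(0\<^sub>v \<alpha>, 0\<^sub>v \<beta>) \<in> P"
      using linear_code_zero[OF C] linear_code_zero[OF E] y by (simp add: P_def zero_vec_Suc)
    fix g r assume gr: "(g, r) \<in> P"
    then have r: "r \<in> carrier_vec \<beta>"
      using C unfolding P_def linear_code_iff by blast
    show "(eta d \<cdot>\<^sub>v g, d \<cdot>\<^sub>v r) \<in> P" for d
      using gr linear_code_smult[OF C, of g r d]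
        linear_code_smult[OF E, of g "vCons (r \<bullet> y) (vCons (t * (r \<bullet> y)) r)" d] r y
      by (simp add: P_def mult.left_commute)
    fix g' r' assume gr': "(g', r') \<in> P"
    then have r': "r' \<in> carrier_vec \<beta>"
      using C unfolding P_def linear_code_iff by blast
    show "(g + g', r + r') \<in> P"
      using gr gr' linear_code_add[OF C, of g r g' r']
        linear_code_add[OF E, of g "vCons (r \<bullet> y) (vCons (t * (r \<bullet> y)) r)" g'
          "vCons (r' \<bullet> y) (vCons (t * (r' \<bullet> y)) r')"] r r' y
      by (simp add: P_def add_scalar_prod_distrib[of _ \<beta>] distrib_left)
  qed
  moreover have "mixed_rows A B \<subseteq> P"
    using A rows_C rows_E[of "Suc _"] by (auto simp: mixed_rows_def P_def row_Suc)
  ultimately have "?C \<subseteq> P"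
    by (rule generated_code_least)
  then have ext: "(g, vCons (r \<bullet> y) (vCons (t * (r \<bullet> y)) r)) \<in> ?E" if "(g, r) \<in> ?C" for g r
    using that unfolding P_def by blast
  show "extended_code y t ?C \<subseteq> ?E"
  proof clarify
    fix g v assume "(g, v) \<in> extended_code y t ?C"
    then obtain r d where gr: "(g, r) \<in> ?C"
      and v: "v = vCons (d + r \<bullet> y) (vCons (t * (r \<bullet> y)) (d \<cdot>\<^sub>v y + r))"
      by (rule extended_codeE)
    note rc = linear_code_carrier[OF C gr]
    have xc: "x \<in> carrier_vec \<alpha>"
      using linear_code_carrier[OF C x] by blast
    \<comment> \<open>Adding this extension of \<open>(x, 0)\<close> to the first row clears
      \<open>x\<close>, because \<open>x + x\<close> vanishes.\<close>
    have "(x, vCons 0 (vCons 0 (0\<^sub>v \<beta>))) \<in> ?E"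
      using ext[OF x] y by simp
    from linear_code_add[OF E this rows_E[of 0]]
    have "(x + x, vCons 1 (vCons 0 y)) \<in> ?E"
      using y by (simp add: row0)
    moreover have "x + x = 0\<^sub>v \<alpha>"
      using xc by (intro eq_vecI) auto
    ultimately have "(0\<^sub>v \<alpha>, vCons 1 (vCons 0 y)) \<in> ?E" by simp
    from linear_code_add[OF E linear_code_smult[OF E this, of d] ext[OF gr]]
    show "(g, v) \<in> ?E"
      using rc by (simp add: v)
  qed
qed

theorem theorem3p6:
  fixes \<alpha> \<beta> \<gamma> \<delta> \<kappa> :: nat
    and C :: "(bit vec \<times> z2u vec) set"
    and A :: "bit mat" and B :: "z2u mat"
    and x :: "bit vec" and y :: "z2u vec"
    and t :: z2u and s :: "nat \<Rightarrow> z2u"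
  assumes "linear_code \<alpha> \<beta> C"
    and "self_dual \<alpha> \<beta> C"
    and "code_type \<alpha> \<beta> \<gamma> \<delta> \<kappa> C"
    and "generator_matrix (\<gamma> + \<delta>) \<alpha> \<beta> A B C"
    and "y \<in> carrier_vec \<beta>" and "odd (wt_L y)"
    and "x \<in> carrier_vec \<alpha>" and "even (wt_H x)"
    and "\<forall>i < \<gamma> + \<delta>. row A i \<bullet> x = 0"
    and "t dvd 1"
    and "\<forall>i < \<gamma> + \<delta>. s i = row B i \<bullet> y"
  shows "let G\<^sub>X = mat_of_rows \<alpha> (x # rows A);
             G\<^sub>Y = mat_of_rows (\<beta> + 2)
               ((vec_of_list [1, 0] @\<^sub>v y) #
                map (\<lambda>i. vec_of_list [s i, t * s i] @\<^sub>v row B i) [0..<\<gamma> + \<delta>]);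
             E = generated_code \<alpha> (\<beta> + 2) G\<^sub>X G\<^sub>Y
         in linear_code \<alpha> (\<beta> + 2) E \<and> self_dual \<alpha> (\<beta> + 2) E \<and>
            (separable E \<longleftrightarrow> separable C)"
proof -
  note C = assms(1) and sd = assms(2) and y = assms(5) and x = assms(7)
  have A: "A \<in> carrier_mat (\<gamma> + \<delta>) \<alpha>" and B: "B \<in> carrier_mat (\<gamma> + \<delta>) \<beta>"
    and gen: "generated_code \<alpha> \<beta> A B = C"
    using assms(4) unfolding generator_matrix_def by auto
  have yy: "y \<bullet> y = 1"
    using assms(6) by (simp add: scalar_prod_self_eq_wt_L of_nat_z2u_odd)
  have tt: "t * t = 1"
    using assms(10) by (rule z2u_unit_square)
  \<comment> \<open>The vectors orthogonal to \<open>(x, 0)\<close> form a linear code containing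
    the rows, so orthogonality passes from the generators to all of \<open>C\<close>; self-duality
    then puts \<open>(x, 0)\<close> into \<open>C\<close>.\<close>
  have "generated_code \<alpha> \<beta> A B \<subseteq> dual_code \<alpha> \<beta> {(x, 0\<^sub>v \<beta>)}"
  proof (rule generated_code_least)
    show "linear_code \<alpha> \<beta> (dual_code \<alpha> \<beta> {(x, 0\<^sub>v \<beta>)})"
      using x unfolding linear_code_iff dual_code_def mixed_inner_def
      by (auto simp: add_scalar_prod_distrib[of _ \<alpha>] uu_lift_bit_add uu_lift_bit_mult)
    show "mixed_rows A B \<subseteq> dual_code \<alpha> \<beta> {(x, 0\<^sub>v \<beta>)}"
      using A B assms(9) by (auto simp: mixed_rows_def dual_code_def mixed_inner_def)
  qed
  then have "(x, 0\<^sub>v \<beta>) \<in> dual_code \<alpha> \<beta> C"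
    using x comm_scalar_prod[of _ \<alpha> x] unfolding gen by (auto simp: dual_code_def mixed_inner_def)
  then have x0: "(x, 0\<^sub>v \<beta>) \<in> generated_code \<alpha> \<beta> A B"
    using sd unfolding gen self_dual_def by simp
  define G\<^sub>X where "G\<^sub>X = mat_of_rows \<alpha> (x # rows A)"
  define G\<^sub>Y where "G\<^sub>Y = mat_of_rows (\<beta> + 2)
    ((vec_of_list [1, 0] @\<^sub>v y) #
     map (\<lambda>i. vec_of_list [s i, t * s i] @\<^sub>v row B i) [0..<\<gamma> + \<delta>])"
  have "generated_code \<alpha> (\<beta> + 2) G\<^sub>X G\<^sub>Y = extended_code y t (generated_code \<alpha> \<beta> A B)"
  proof (rule generated_code_eq_extended_code[OF A B y x0])
    show "G\<^sub>X \<in> carrier_mat (Suc (\<gamma> + \<delta>)) \<alpha>" "G\<^sub>Y \<in> carrier_mat (Suc (\<gamma> + \<delta>)) (\<beta> + 2)"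
      using A by (auto simp: G\<^sub>X_def G\<^sub>Y_def)
    show "row G\<^sub>X 0 = x" "row G\<^sub>Y 0 = vCons 1 (vCons 0 y)"
      using x y by (auto simp: G\<^sub>X_def G\<^sub>Y_def mat_of_rows_row)
    show "row G\<^sub>X (Suc i) = row A i" if "i < \<gamma> + \<delta>" for i
      using A that by (auto simp: G\<^sub>X_def mat_of_rows_row)
    show "row G\<^sub>Y (Suc i) = vCons (row B i \<bullet> y) (vCons (t * (row B i \<bullet> y)) (row B i))"
      if "i < \<gamma> + \<delta>" for i
      using B that assms(11) by (auto simp: G\<^sub>Y_def mat_of_rows_row)
  qed
  then have "generated_code \<alpha> (\<beta> + 2) G\<^sub>X G\<^sub>Y = extended_code y t C"
    by (simp only: gen)
  then show ?thesis
    unfolding Let_def G\<^sub>X_def[symmetric] G\<^sub>Y_def[symmetric]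
    using extended_code_linear[OF C y] extended_code_self_dual[OF C sd y yy tt]
      extended_code_separable_iff[OF C y tt] by simp
qed

end
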